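(* Let $n$ and $m$ be non-negative integers. The number of partitions of $n$ with no two consecutive integers as parts (i.e. there is no integer $k$ such that both $k$ and $k+1$ occur as parts), with all parts $\geq 2$, and with exactly $m$ odd parts, is equal to the number of partitions of $n$ into parts congruent to $0,2,3$ or $4$ modulo $6$ with exactly $m$ odd parts.
   Context: A partition is a finite non-increasing sequence of positive integers, called its parts; it is a partition of $n$ if its parts sum to $n$. The empty sequence is the unique partition of $0$. Parts may be repeated, and the number of odd parts is counted with multiplicity. *)

theory Defs
  imports Main
begin

definition partitions :: "nat \<Rightarrow> nat list set" where
  "partitions n = {p. sorted_wrt (\<ge>) p \<and> (\<forall>x\<in>set p. 0 < x) \<and> sum_list p = n}"

definition num_odd_parts :: "nat list \<Rightarrow> nat" where
  "num_odd_parts p = length (filter odd p)"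

definition no_consecutive_parts :: "nat list \<Rightarrow> bool" where
  "no_consecutive_parts p \<longleftrightarrow> \<not> (\<exists>k. k \<in> set p \<and> k + 1 \<in> set p)"

(* Ensures that card, applied to sets of partitions of n, is a genuine count. *)
lemma finite_partitions: "finite (partitions n)"
proof (rule finite_subset)
  have len: "(\<forall>x\<in>set p. 0 < x) \<Longrightarrow> length p \<le> sum_list p" for p :: "nat list"
    by (induction p) auto
  show "partitions n \<subseteq> {p. set p \<subseteq> {..n} \<and> length p \<le> n}"
    using len by (auto simp: partitions_def member_le_sum_list)
  show "finite {p. set p \<subseteq> {..n} \<and> length p \<le> n}"
    by (rule finite_lists_length_le) simp
qed

end

theory Submission
  imports Defs "HOL-Library.Multiset"
begin

text \<open>
  A partition \<open>p\<close> with all parts at least 2 and no consecutive parts is one in which no difference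
  of neighbouring parts (including the last part minus 0) equals 1. Each difference is thus
  uniquely \<open>2h\<close> or \<open>3 + 2h\<close>. Equivalently, the conjugate of \<open>p\<close> consists of three copies of a
  partition \<open>d\<close> into distinct parts together with two copies of an arbitrary partition \<open>v\<close>, and
  the number of odd parts of \<open>p\<close> is the alternating sum of \<open>d\<close>. Sylvester's bijection turns \<open>d\<close>
  into a partition \<open>o\<close> into odd parts, of the same size, whose number of parts is that
  alternating sum. The parts \<open>3 o\<^sub>i\<close> and \<open>2 v\<^sub>j\<close> together form the partition into parts
  congruent to 0, 2, 3 or 4 modulo 6.
\<close>

section \<open>Splitting a partition by its differences\<close>

text \<open>Below, partitions are read in ascending order, \<open>c\<close> being the part preceding the list. A
  difference in front of \<open>l\<close> remaining parts contributes parts of size \<open>l\<close> to the conjugate.\<close>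

fun no_unit_gaps :: "nat \<Rightarrow> nat list \<Rightarrow> bool" where
  "no_unit_gaps c [] \<longleftrightarrow> True"
| "no_unit_gaps c (x # xs) \<longleftrightarrow> c \<le> x \<and> x \<noteq> Suc c \<and> no_unit_gaps x xs"

fun triples :: "nat \<Rightarrow> nat list \<Rightarrow> nat list" where
  "triples c [] = []"
| "triples c (x # xs) = (if odd (x - c) then [Suc (length xs)] else []) @ triples x xs"

fun doubles :: "nat \<Rightarrow> nat list \<Rightarrow> nat list" where
  "doubles c [] = []"
| "doubles c (x # xs) =
    replicate ((x - c - (if odd (x - c) then 3 else 0)) div 2) (Suc (length xs)) @ doubles x xs"

text \<open>The subtraction does not truncate on strictly decreasing lists.\<close>

fun altsum :: "nat list \<Rightarrow> nat" where
  "altsum [] = 0"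
| "altsum (d # ds) = d - altsum ds"

text \<open>No integer lies strictly between \<open>k\<close> and \<open>Suc k\<close>, so in a
  sorted list two consecutive values are already visible at neighbouring positions. For
  \<open>c = 0\<close> the value 1 is excluded as well.\<close>

lemma no_unit_gaps_iff:
  "no_unit_gaps c xs \<longleftrightarrow> sorted (c # xs) \<and> (\<forall>k. k \<in> set (c # xs) \<longrightarrow> Suc k \<notin> set (c # xs))"
proof (induction xs arbitrary: c)
  case Nil
  then show ?case by auto
next
  case (Cons x xs)
  show ?case
  proof
    assume "no_unit_gaps c (x # xs)"
    then have c: "c \<le> x" "x \<noteq> Suc c" and s: "sorted (x # xs)"
      and k: "\<forall>k. k \<in> set (x # xs) \<longrightarrow> Suc k \<notin> set (x # xs)"
      using Cons.IH[of x] by simp_all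
    have le: "x \<le> k" if "k \<in> set (x # xs)" for k
      using s that by auto
    have "Suc k \<notin> set (c # x # xs)" if "k \<in> set (c # x # xs)" for k
    proof
      assume "Suc k \<in> set (c # x # xs)"
      moreover have "Suc k \<noteq> c"
        using that le[of k] c(1) by auto
      ultimately have k': "Suc k \<in> set (x # xs)" by simp
      then have "k = c" using that k by auto
      \<comment> \<open>\<open>Suc c\<close> occurs in \<open>x # xs\<close>, so
        \<open>c <= x <= Suc c\<close>, and the unit gap is excluded.\<close>
      then have "x = c" using le[OF k'] c by simp
      then show False using k k' \<open>k = c\<close> by (metis list.set_intros(1))
    qed
    moreover have "sorted (c # x # xs)"
      using s c(1) by simp fastforce
    ultimately show "sorted (c # x # xs) \<and> (\<forall>k. k \<in> set (c # x # xs) \<longrightarrow> Suc k \<notin> set (c # x # xs))"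
      by blast
  next
    assume "sorted (c # x # xs) \<and> (\<forall>k. k \<in> set (c # x # xs) \<longrightarrow> Suc k \<notin> set (c # x # xs))"
    then show "no_unit_gaps c (x # xs)"
      using Cons.IH[of x] by (metis no_unit_gaps.simps(2) list.set_intros(1,2) sorted_simps(2))
  qed
qed

lemma set_triples: "set (triples c xs) \<subseteq> {0<..length xs}"
  by (induction c xs rule: triples.induct) auto

lemma set_doubles: "set (doubles c xs) \<subseteq> {0<..length xs}"
  by (induction c xs rule: doubles.induct) auto

lemma triples_bounds: "d \<in> set (triples c xs) \<Longrightarrow> 0 < d \<and> d \<le> length xs"
  using set_triples by fastforce

lemma doubles_bounds: "d \<in> set (doubles c xs) \<Longrightarrow> 0 < d \<and> d \<le> length xs"
  using set_doubles by fastforce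

lemma sorted_triples: "sorted_wrt (>) (triples c xs)"
  by (induction c xs rule: triples.induct)
     (auto simp: sorted_wrt_append less_Suc_eq_le dest: triples_bounds)

lemma sorted_wrt_replicate: "sorted_wrt (\<ge>) (replicate k (a::nat))"
  by (induction k) auto

lemma sorted_doubles: "sorted_wrt (\<ge>) (doubles c xs)"
  by (induction c xs rule: doubles.induct)
     (auto simp: sorted_wrt_append sorted_wrt_replicate dest!: doubles_bounds)

text \<open>An odd difference other than 1 is at least 3, so subtracting 3 does not
  truncate.\<close>

lemma diff_eq:
  assumes "c \<le> x" "x \<noteq> Suc c"
  shows "x = c + (if odd (x - c) then 3 else 0)
           + 2 * ((x - c - (if odd (x - c) then 3 else 0)) div 2)"
  using assms by (auto elim!: oddE evenE) presburger+

text \<open>Double counting: a difference in front of l remaining parts contributes l times itself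
  to the sum, and the base \<open>c\<close> is counted once per part.\<close>

lemma sum_list_no_unit_gaps:
  "no_unit_gaps c xs \<Longrightarrow>
    sum_list xs = c * length xs + 3 * sum_list (triples c xs) + 2 * sum_list (doubles c xs)"
proof (induction xs arbitrary: c)
  case (Cons x xs)
  define b where "b = (if odd (x - c) then 3 else 0 :: nat)"
  define h where "h = (x - c - b) div 2"
  have x: "x = c + b + 2 * h"
    using diff_eq[of c x] Cons.prems unfolding b_def h_def by simp
  have t: "3 * sum_list (triples c (x # xs)) = b * Suc (length xs) + 3 * sum_list (triples x xs)"
    by (simp add: b_def)
  have d: "sum_list (doubles c (x # xs)) = h * Suc (length xs) + sum_list (doubles x xs)"
    by (simp add: b_def h_def sum_list_replicate)
  have "sum_list (x # xs) = x * Suc (length xs) + 3 * sum_list (triples x xs) + 2 * sum_list (doubles x xs)"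
    using Cons.IH[of x] Cons.prems by simp
  also have "\<dots> = c * Suc (length xs) + b * Suc (length xs) + 2 * (h * Suc (length xs))
      + 3 * sum_list (triples x xs) + 2 * sum_list (doubles x xs)"
    by (subst x) (simp add: algebra_simps)
  finally show ?case
    unfolding t d by simp
qed auto

text \<open>An odd first difference reverses parity relative to the base, so the count for the tail
  is replaced by its complement in the length of the whole list. This is the recursion of
  \<open>altsum\<close>; for \<open>c = 0\<close> it counts odd parts.\<close>

lemma altsum_triples:
  "no_unit_gaps c xs \<Longrightarrow> altsum (triples c xs) = length (filter (\<lambda>x. odd (x + c)) xs)"
proof (induction xs arbitrary: c)
  case (Cons x xs)
  have IH: "altsum (triples x xs) = length (filter (\<lambda>y. odd (y + x)) xs)"
    using Cons by simp
  show ?case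
  proof (cases "odd (x - c)")
    case True
    then have "odd (x + c)" using Cons.prems by simp
    then have "filter (\<lambda>y. odd (y + c)) xs = filter (\<lambda>y. \<not> odd (y + x)) xs"
      by (intro filter_cong) auto
    moreover have "length (filter (\<lambda>y. odd (y + x)) xs) + length (filter (\<lambda>y. \<not> odd (y + x)) xs)
        = length xs"
      by (rule sum_length_filter_compl)
    ultimately show ?thesis
      using True IH \<open>odd (x + c)\<close> by simp
  next
    case False
    then have "even (x + c)" using Cons.prems by simp
    then have "filter (\<lambda>y. odd (y + c)) xs = filter (\<lambda>y. odd (y + x)) xs"
      by (intro filter_cong) auto
    then show ?thesis
      using False IH \<open>even (x + c)\<close> by simp
  qed
qed auto

section \<open>Bijectivity of the splitting\<close>

lemma replicate_append_eq:
  assumes "replicate j a @ xs = replicate k a @ ys" "a \<notin> set xs" "a \<notin> set ys"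
  shows "j = k \<and> xs = ys"
proof -
  have "filter ((=) a) (replicate j a @ xs) = filter ((=) a) (replicate k a @ ys)"
    using assms by simp
  moreover have "filter ((=) a) xs = []" "filter ((=) a) ys = []"
    using assms by (auto simp: filter_empty_conv)
  ultimately have "replicate j a = replicate k a" by simp
  then have "j = k" by (metis length_replicate)
  then show ?thesis using assms by simp
qed

text \<open>Only the first difference produces the size equal to the length of the list. Its
  presence among the triples gives the parity and its multiplicity among the doubles gives the half,
  hence the first entry. The lengths must agree because leading copies of \<open>c\<close> leave no
  trace.\<close>

lemma triples_doubles_inj:
  assumes "no_unit_gaps c xs" "no_unit_gaps c ys" "length xs = length ys"
    and "triples c xs = triples c ys" "doubles c xs = doubles c ys"
  shows "xs = ys"
  using assms
proof (induction xs arbitrary: c ys)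
  case (Cons x xs)
  then obtain y ys' where y: "ys = y # ys'" and len: "length xs = length ys'"
    by (cases ys) auto
  have n: "Suc (length xs) \<notin> set (triples d zs)" "Suc (length xs) \<notin> set (doubles d zs)"
    if "length zs = length xs" for d zs
    using that triples_bounds[of "Suc (length xs)" d zs] doubles_bounds[of "Suc (length xs)" d zs]
    by auto
  have "odd (x - c) \<longleftrightarrow> Suc (length xs) \<in> set (triples c (x # xs))"
    using n(1)[of xs x] by simp
  moreover have "odd (y - c) \<longleftrightarrow> Suc (length xs) \<in> set (triples c ys)"
    using n(1)[of ys' y] len y by simp
  ultimately have odd_eq: "odd (x - c) \<longleftrightarrow> odd (y - c)"
    unfolding Cons.prems(4) by blast
  then have t: "triples x xs = triples y ys'"
    using Cons.prems(4) unfolding y triples.simps by (simp split: if_splits)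
  have d: "(x - c - (if odd (x - c) then 3 else 0)) div 2
      = (y - c - (if odd (y - c) then 3 else 0)) div 2 \<and> doubles x xs = doubles y ys'"
    using Cons.prems(5) n(2)[of xs x] n(2)[of ys' y] len
    by (intro replicate_append_eq) (simp_all add: y)
  have "x = c + (if odd (x - c) then 3 else 0)
      + 2 * ((x - c - (if odd (x - c) then 3 else 0)) div 2)"
    using diff_eq Cons.prems(1) by simp
  also have "\<dots> = c + (if odd (y - c) then 3 else 0)
      + 2 * ((y - c - (if odd (y - c) then 3 else 0)) div 2)"
    using d by (simp only: odd_eq)
  also have "\<dots> = y"
    using diff_eq[symmetric] Cons.prems(2) y by simp
  finally have "x = y" .
  then show ?case
    using Cons.IH[of x ys'] Cons.prems(1,2) t d len y by simp
qed auto

lemma decreasing_split_max: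
  assumes "sorted_wrt (\<ge>) v" "set v \<subseteq> {0<..Suc l}"
  obtains k v' where "v = replicate k (Suc l) @ v'" "sorted_wrt (\<ge>) v'" "set v' \<subseteq> {0<..l}"
proof -
  have "\<exists>k v'. v = replicate k (Suc l) @ v' \<and> sorted_wrt (\<ge>) v' \<and> set v' \<subseteq> {0<..l}"
    using assms
  proof (induction v)
    case (Cons a v)
    show ?case
    proof (cases "a = Suc l")
      case True
      obtain k v' where "v = replicate k (Suc l) @ v'" "sorted_wrt (\<ge>) v'" "set v' \<subseteq> {0<..l}"
        using Cons by auto
      then show ?thesis
        using True by (intro exI[of _ "Suc k"] exI[of _ v']) auto
    next
      case False
      then have "set (a # v) \<subseteq> {0<..l}"
        using Cons.prems by fastforce
      then show ?thesis
        using Cons.prems by (intro exI[of _ 0] exI[of _ "a # v"]) auto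
    qed
  qed auto
  then show ?thesis using that by blast
qed

lemma triples_doubles_surj:
  assumes "sorted_wrt (>) d" "set d \<subseteq> {0<..l}" "sorted_wrt (\<ge>) v" "set v \<subseteq> {0<..l}"
  shows "\<exists>xs. no_unit_gaps c xs \<and> length xs = l \<and> triples c xs = d \<and> doubles c xs = v"
  using assms
proof (induction l arbitrary: c d v)
  case (Suc l)
  obtain k v' where v: "v = replicate k (Suc l) @ v'" "sorted_wrt (\<ge>) v'" "set v' \<subseteq> {0<..l}"
    using decreasing_split_max Suc.prems(3,4) by blast
  obtain b d' where d: "d = (if b then [Suc l] else []) @ d'" "sorted_wrt (>) d'" "set d' \<subseteq> {0<..l}"
  proof (cases "Suc l \<in> set d")
    case True
    then obtain a d' where a: "d = a # d'" by (cases d) auto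
    have "a = Suc l"
      using True Suc.prems(1,2) unfolding a by fastforce
    then show ?thesis
      using that[of True d'] Suc.prems(1,2) a by fastforce
  next
    case False
    then have "set d \<subseteq> {0<..l}"
      using False Suc.prems(2) by (auto simp: subset_iff le_Suc_eq)
    then show ?thesis
      using that[of False d] Suc.prems(1) by simp
  qed
  \<comment> \<open>\<open>b\<close> and \<open>k\<close> record whether and how often the maximal
    size occurs in \<open>d\<close> and \<open>v\<close>; the difference \<open>2 * k\<close> or
    \<open>3 + 2 * k\<close> is never 1.\<close>
  define x where "x = c + (if b then 3 else 0) + 2 * k"
  obtain xs where xs: "no_unit_gaps x xs" "length xs = l" "triples x xs = d'" "doubles x xs = v'"
    using Suc.IH[OF d(2,3) v(2,3)] by blast
  have "odd (x - c) \<longleftrightarrow> b" "c \<le> x" "x \<noteq> Suc c"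
    and "(x - c - (if b then 3 else 0)) div 2 = k"
    unfolding x_def by (auto; presburger)+
  then show ?case
    using xs d(1) v(1) by (intro exI[of _ "x # xs"]) auto
qed auto

section \<open>Sylvester's bijection\<close>

text \<open>The two largest parts \<open>a\<close> and \<open>b\<close> determine the first row and the first column (of
  width 2 below the first row) of the image; what remains is the image of the other parts. The
  second equation is the third one with \<open>b = 0\<close> and \<open>ds = []\<close>.\<close>

fun sylvester :: "nat list \<Rightarrow> nat list" where
  "sylvester [] = []"
| "sylvester [d] = replicate d 1"
| "sylvester (a # b # ds) =
    Suc (2 * (b - length (sylvester ds))) # map ((+) 2) (sylvester ds) @ replicate (a - b - 1) 1"

definition distinct_partitions :: "nat list set" where
  "distinct_partitions = {d. sorted_wrt (>) d \<and> (\<forall>x\<in>set d. 0 < x)}"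

definition odd_partitions :: "nat list set" where
  "odd_partitions = {p. sorted_wrt (\<ge>) p \<and> (\<forall>x\<in>set p. odd x)}"

section \<open>Length, size and shape of the image\<close>

lemma distinct_partitions_Cons:
  "a # d \<in> distinct_partitions \<longleftrightarrow>
    0 < a \<and> d \<in> distinct_partitions \<and> (d \<noteq> [] \<longrightarrow> hd d < a)"
  by (cases d) (auto simp: distinct_partitions_def)

lemma altsum_le_hd: "d \<in> distinct_partitions \<Longrightarrow> altsum d \<le> (case d of [] \<Rightarrow> 0 | a # _ \<Rightarrow> a)"
  by (cases d) auto

text \<open>\<open>1 + altsum ds + (a - b - 1) = a - (b - altsum ds)\<close>, where
  \<open>altsum ds < b < a\<close> keeps the subtractions exact.\<close>

lemma length_sylvester:
  "d \<in> distinct_partitions \<Longrightarrow> length (sylvester d) = altsum d"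
proof (induction d rule: sylvester.induct)
  case (3 a b ds)
  then have "ds \<in> distinct_partitions" "b < a"
    and "altsum ds < b"
    using altsum_le_hd[of ds]
    by (auto simp: distinct_partitions_Cons split: list.splits)
  then show ?case using 3 by simp
qed auto

text \<open>Makes the difference in the first part of \<open>sylvester (a # b # ds)\<close> exact
  and positive, so that part is at least 3.\<close>

lemma length_sylvester_less:
  "b # ds \<in> distinct_partitions \<Longrightarrow> length (sylvester ds) < b"
  using altsum_le_hd[of ds] length_sylvester[of ds]
  by (auto simp: distinct_partitions_Cons split: list.splits)

text \<open>Passing from \<open>ds\<close> to \<open>a # b # ds\<close> lengthens the image by
  \<open>a - b\<close>, so the first part can be expressed through the largest part \<open>a\<close>
  alone; singletons obey the same formula.\<close>

lemma hd_sylvester: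
  "a # d \<in> distinct_partitions \<Longrightarrow>
    sylvester (a # d) \<noteq> [] \<and> hd (sylvester (a # d)) = Suc (2 * (a - length (sylvester (a # d))))"
proof (cases d)
  case Nil
  moreover assume "a # d \<in> distinct_partitions"
  ultimately show ?thesis by (simp add: distinct_partitions_Cons)
next
  case (Cons b ds)
  assume "a # d \<in> distinct_partitions"
  then have "b < a" "length (sylvester ds) < b"
    using length_sylvester_less[of b ds] Cons by (auto simp: distinct_partitions_Cons)
  then show ?thesis by (simp add: Cons)
qed

text \<open>The shift by 2 adds \<open>2 * length (sylvester ds)\<close>, exactly what the first
  part subtracts.\<close>

lemma sum_list_sylvester:
  "d \<in> distinct_partitions \<Longrightarrow> sum_list (sylvester d) = sum_list d"
proof (induction d rule: sylvester.induct)
  case (3 a b ds)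
  have "sum_list (map ((+) 2) p) = 2 * length p + sum_list p" for p :: "nat list"
    by (induction p) auto
  moreover have "b < a" "length (sylvester ds) < b" "ds \<in> distinct_partitions"
    using length_sylvester_less[of b ds] 3 by (auto simp: distinct_partitions_Cons)
  ultimately show ?case
    using "3.IH" by (simp add: sum_list_replicate)
qed (auto simp: sum_list_replicate)

lemma sylvester_in_odd_partitions:
  "d \<in> distinct_partitions \<Longrightarrow> sylvester d \<in> odd_partitions"
proof (induction d rule: sylvester.induct)
  case (3 a b ds)
  then have ds: "b # ds \<in> distinct_partitions" "ds \<in> distinct_partitions"
    by (auto simp: distinct_partitions_Cons)
  have IH: "sylvester ds \<in> odd_partitions"
    using 3 ds by blast
  \<comment> \<open>With \<open>e\<close> the largest part of \<open>ds\<close>, the formula for the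
    first part reduces this to \<open>e < b\<close>.\<close>
  have le: "2 + x \<le> Suc (2 * (b - length (sylvester ds)))" if x: "x \<in> set (sylvester ds)" for x
  proof -
    obtain e es where es: "ds = e # es"
      using x by (cases ds) auto
    have "x \<le> hd (sylvester ds)"
      using IH x by (cases "sylvester ds") (auto simp: odd_partitions_def)
    moreover have "hd (sylvester ds) = Suc (2 * (e - length (sylvester ds)))"
      using hd_sylvester ds es by simp
    moreover have "e < b" "length (sylvester ds) \<le> e"
      using ds es length_sylvester[of ds] altsum_le_hd[of ds]
      by (auto simp: distinct_partitions_Cons)
    ultimately show ?thesis by simp
  qed
  show ?case
    using IH le
    by (auto simp: odd_partitions_def sorted_wrt_append sorted_wrt_map sorted_wrt_replicate)
qed (auto simp: odd_partitions_def sorted_wrt_replicate)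

section \<open>Bijectivity of Sylvester's map\<close>

lemma append_replicate_eq:
  assumes "map ((+) 2) xs @ replicate j 1 = map ((+) 2) ys @ replicate k (1::nat)"
    and "0 \<notin> set xs" "0 \<notin> set ys"
  shows "xs = ys \<and> j = k"
proof -
  have f: "filter (\<lambda>z. z \<noteq> 1) (map ((+) 2) zs @ replicate i 1) = map ((+) 2) zs"
    if "0 \<notin> set zs" for zs :: "nat list" and i
    using that
    by (induction zs) auto
  have "map ((+) 2) xs = map ((+) 2) ys"
    using assms f by metis
  then show ?thesis
    using assms(1) by (auto simp: inj_on_def dest: map_injective)
qed

text \<open>A one-part partition has an image of ones only, a longer one an image with first part at
  least 3. In the latter case the trailing ones split off, the shifted rest determines
  \<open>ds\<close> by induction, the first part then gives \<open>b\<close>, and the number of ones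
  gives \<open>a\<close>.\<close>

lemma sylvester_inj:
  assumes "d \<in> distinct_partitions" "e \<in> distinct_partitions" "sylvester d = sylvester e"
  shows "d = e"
  using assms
proof (induction d arbitrary: e rule: sylvester.induct)
  case 1
  then show ?case
    using hd_sylvester by (cases e) force+
next
  case (2 d)
  then show ?case
  proof (cases e rule: sylvester.cases)
    case (3 a b ds)
    then have "b - length (sylvester ds) = 0"
      using 2 by (cases d) auto
    then show ?thesis
      using length_sylvester_less[of b ds] 2 3 by (auto simp: distinct_partitions_Cons)
  qed (auto simp: distinct_partitions_Cons dest: arg_cong[of _ _ length])
next
  case (3 a b ds)
  then have ds: "b # ds \<in> distinct_partitions" "ds \<in> distinct_partitions" "b < a"
    by (auto simp: distinct_partitions_Cons)
  have less: "length (sylvester ds) < b"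
    using length_sylvester_less ds by blast
  show ?case
  proof (cases e rule: sylvester.cases)
    case 1
    then show ?thesis using 3 by simp
  next
    case (2 d)
    then have "b - length (sylvester ds) = 0"
      using 3 by (cases d) auto
    then show ?thesis using less by simp
  next
    case e: (3 a' b' ds')
    then have ds': "b' # ds' \<in> distinct_partitions" "ds' \<in> distinct_partitions" "b' < a'"
      using 3 by (auto simp: distinct_partitions_Cons)
    have less': "length (sylvester ds') < b'"
      using length_sylvester_less ds' by blast
    have "sylvester ds = sylvester ds' \<and> a - b - 1 = a' - b' - 1"
      using 3 e ds ds'
      by (intro append_replicate_eq)
         (auto simp: odd_partitions_def dest!: sylvester_in_odd_partitions)
    moreover have "b - length (sylvester ds) = b' - length (sylvester ds')"
      using 3 e by simp
    moreover have "ds = ds'"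
      using calculation 3 ds ds' by blast
    ultimately show ?thesis
      using e less less' ds ds' by auto
  qed
qed

text \<open>All parts before the trailing ones are at least 3, and lowering them by 2 keeps them
  odd.\<close>

lemma odd_partitions_split:
  assumes "p \<in> odd_partitions"
  obtains q k where "p = map ((+) 2) q @ replicate k 1" "q \<in> odd_partitions"
proof -
  have "\<exists>q k. p = map ((+) 2) q @ replicate k 1 \<and> q \<in> odd_partitions"
    using assms
  proof (induction p)
    case Nil
    then show ?case by (intro exI[of _ "[]"] exI[of _ 0]) simp
  next
    case (Cons a p)
    then have "p \<in> odd_partitions" by (simp add: odd_partitions_def)
    then obtain q k where p: "p = map ((+) 2) q @ replicate k 1" and q: "q \<in> odd_partitions"
      using Cons.IH by blast
    show ?case
    proof (cases "a = 1")
      case True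
      then have "q = []"
        using Cons.prems p by (cases q) (auto simp: odd_partitions_def)
      then show ?thesis
        using True p q by (intro exI[of _ "[]"] exI[of _ "Suc k"]) simp
    next
      case False
      then obtain a' where a: "a = 2 + a'" "odd a'"
        using Cons.prems by (auto simp: odd_partitions_def elim!: oddE)
          (metis One_nat_def Suc_pred add_2_eq_Suc dvd_triv_left even_Suc gr0I mult_0_right mult_Suc_right)
      then show ?thesis
        using Cons.prems p q
        by (intro exI[of _ "a' # q"] exI[of _ k]) (auto simp: odd_partitions_def)
    qed
  qed
  then show ?thesis using that by blast
qed

text \<open>Inverts the recursion: without its first part and its ones, and lowered by 2, the
  partition is shorter and has a preimage \<open>ds\<close>.\<close>

lemma sylvester_surj:
  "p \<in> odd_partitions \<Longrightarrow> \<exists>d\<in>distinct_partitions. sylvester d = p"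
proof (induction p rule: length_induct)
  case (1 p)
  show ?case
  proof (cases p)
    case Nil
    then show ?thesis by (intro bexI[of _ "[]"]) (auto simp: distinct_partitions_def)
  next
    case (Cons h t)
    then have "t \<in> odd_partitions" "odd h" and le: "\<forall>x\<in>set t. x \<le> h"
      using 1 by (auto simp: odd_partitions_def)
    then obtain q k where t: "t = map ((+) 2) q @ replicate k 1" and q: "q \<in> odd_partitions"
      using odd_partitions_split by blast
    obtain c where h: "h = Suc (2 * c)"
      using \<open>odd h\<close> by (auto elim: oddE)
    have "length q < length p"
      using Cons t by simp
    then obtain ds where ds: "ds \<in> distinct_partitions" "sylvester ds = q"
      using 1 q by blast
    show ?thesis
    proof (cases "c = 0")
      case True
      then have "q = []"
        using le t h by (cases q) auto
      then show ?thesis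
        using True Cons t h
        by (intro bexI[of _ "[Suc k]"]) (auto simp: distinct_partitions_def)
    next
      case False
      \<comment> \<open>\<open>b\<close> solves \<open>h = Suc (2 * (b - length q))\<close>; the
        largest part \<open>b + Suc k\<close> then yields \<open>k\<close> ones.\<close>
      define b where "b = c + length q"
      have "b # ds \<in> distinct_partitions"
      proof (cases ds)
        case (Cons e es)
        have hd: "q \<noteq> []" "hd q = Suc (2 * (e - length q))"
          using hd_sylvester[of e es] ds Cons by auto
        \<comment> \<open>The second part of \<open>p\<close> is \<open>2 + hd q\<close>; its being
          at most \<open>h\<close> amounts to \<open>e < b\<close>.\<close>
        then have "2 + hd q \<le> h"
          using le t by (cases q) auto
        then have "e < b"
          using hd h b_def by simp
        then show ?thesis
          using ds Cons by (simp add: distinct_partitions_Cons)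
      qed (use False b_def in \<open>auto simp: distinct_partitions_def\<close>)
      then have "(b + Suc k) # b # ds \<in> distinct_partitions"
        by (simp add: distinct_partitions_Cons)
      moreover have "sylvester ((b + Suc k) # b # ds) = p"
        using Cons t h ds by (simp add: b_def)
      ultimately show ?thesis by blast
    qed
  qed
qed

section \<open>Pairs of partitions\<close>

text \<open>\<open>f\<close> is the statistic that becomes the number of odd parts:
  \<open>altsum\<close> for distinct parts, \<open>length\<close> for odd parts.\<close>

definition pairs :: "nat list set \<Rightarrow> (nat list \<Rightarrow> nat) \<Rightarrow> nat \<Rightarrow> nat \<Rightarrow> (nat list \<times> nat list) set" where
  "pairs D f n m = {(d, v). d \<in> D \<and> f d = m \<and> sorted_wrt (\<ge>) v \<and> (\<forall>x\<in>set v. 0 < x) \<and>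
     3 * sum_list d + 2 * sum_list v = n}"

text \<open>The base 0 acts as an extra part, from which a part 1 would have a unit gap.\<close>

lemma no_consecutive_iff_no_unit_gaps:
  "sorted_wrt (\<ge>) p \<and> no_consecutive_parts p \<and> (\<forall>x\<in>set p. 2 \<le> x)
    \<longleftrightarrow> no_unit_gaps 0 (rev p) \<and> (\<forall>x\<in>set p. 0 < x)"
proof -
  have "(\<forall>x\<in>set p. 2 \<le> x) \<longleftrightarrow> Suc 0 \<notin> set p \<and> (\<forall>x\<in>set p. 0 < x)"
    by (auto simp: numeral_2_eq_2 Suc_le_eq) (metis Suc_lessI)
  then show ?thesis
    unfolding no_unit_gaps_iff no_consecutive_parts_def
    by (auto simp: sorted_wrt_rev)
qed

lemma card_no_consecutive:
  "card {p \<in> partitions n. no_consecutive_parts p \<and> (\<forall>x\<in>set p. 2 \<le> x) \<and> num_odd_parts p = m}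
    = card (pairs distinct_partitions altsum n m)" (is "card ?A = card ?P")
proof -
  define f where "f p = (triples 0 (rev p), doubles 0 (rev p))" for p
  have A: "?A = {p. no_unit_gaps 0 (rev p) \<and> (\<forall>x\<in>set p. 0 < x) \<and> sum_list p = n \<and> num_odd_parts p = m}"
    using no_consecutive_iff_no_unit_gaps by (auto simp: partitions_def)
  have f_in: "f p \<in> pairs distinct_partitions altsum (sum_list p) (num_odd_parts p)"
    if "no_unit_gaps 0 (rev p)" for p
    using sum_list_no_unit_gaps[OF that] altsum_triples[OF that]
    by (auto simp: pairs_def f_def distinct_partitions_def sorted_triples sorted_doubles
        num_odd_parts_def rev_filter[symmetric] dest: triples_bounds doubles_bounds)
  \<comment> \<open>The smallest part is neither 0 nor 1, so the first difference does contribute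
    the size \<open>length p\<close>. As the maximum of both lists it is determined by
    \<open>f p\<close>.\<close>
  have len: "length p \<in> set (fst (f p)) \<union> set (snd (f p)) \<and>
      (\<forall>x\<in>set (fst (f p)) \<union> set (snd (f p)). x \<le> length p)"
    if no_unit_gaps: "no_unit_gaps 0 (rev p)" and pos: "\<forall>x\<in>set p. 0 < x" and ne: "p \<noteq> []" for p
  proof -
    obtain x xs where r: "rev p = x # xs"
      using ne by (cases "rev p") auto
    then have "0 < x"
      using pos by (metis list.set_intros(1) set_rev)
    moreover have "x \<noteq> Suc 0"
      using no_unit_gaps r by simp
    moreover have "length p = Suc (length xs)"
      using r by (metis length_Cons length_rev)
    ultimately have "length p \<in> set (fst (f p)) \<union> set (snd (f p))"
      by (auto simp: f_def r elim!: evenE)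
    moreover have "x \<le> length p" if "x \<in> set (fst (f p)) \<union> set (snd (f p))" for x
      using that triples_bounds[of x 0 "rev p"] doubles_bounds[of x 0 "rev p"] by (auto simp: f_def)
    ultimately show ?thesis by blast
  qed
  have "bij_betw f ?A ?P"
    unfolding A
  proof (intro bij_betw_imageI inj_onI subset_antisym subsetI)
    fix p q
    assume "p \<in> {p. no_unit_gaps 0 (rev p) \<and> (\<forall>x\<in>set p. 0 < x) \<and> sum_list p = n \<and> num_odd_parts p = m}"
      and "q \<in> {p. no_unit_gaps 0 (rev p) \<and> (\<forall>x\<in>set p. 0 < x) \<and> sum_list p = n \<and> num_odd_parts p = m}"
      and eq: "f p = f q"
    then have p: "no_unit_gaps 0 (rev p)" "\<forall>x\<in>set p. 0 < x" and q: "no_unit_gaps 0 (rev q)" "\<forall>x\<in>set q. 0 < x"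
      by auto
    have "length p = length q"
    proof (cases "p = [] \<or> q = []")
      case True
      have "f [] = ([], [])" by (simp add: f_def)
      then show ?thesis
        using True len[OF p] len[OF q] eq
        by (metis Un_iff empty_iff fst_conv list.set(1) snd_conv)
    next
      case False
      then show ?thesis
        using len[OF p] len[OF q] eq by (metis le_antisym)
    qed
    then have "rev p = rev q"
      using triples_doubles_inj[of 0 "rev p" "rev q"] eq p(1) q(1) by (simp add: f_def)
    then show "p = q" by simp
  next
    fix z
    assume "z \<in> f ` {p. no_unit_gaps 0 (rev p) \<and> (\<forall>x\<in>set p. 0 < x) \<and> sum_list p = n \<and> num_odd_parts p = m}"
    then show "z \<in> ?P" using f_in by auto
  next
    fix z
    assume z: "z \<in> ?P"
    obtain d v where dv: "z = (d, v)" by (cases z)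
    \<comment> \<open>The preimage has as many parts as the largest size; the inserted 0 covers two
      empty lists.\<close>
    define l where "l = Max (insert 0 (set d \<union> set v))"
    have l: "x \<le> l" if "x \<in> set d \<union> set v" for x
      using that by (auto simp: l_def intro!: Max_ge)
    have "sorted_wrt (>) d" "set d \<subseteq> {0<..l}" "sorted_wrt (\<ge>) v" "set v \<subseteq> {0<..l}"
      using z l by (auto simp: dv pairs_def distinct_partitions_def)
    then obtain xs where xs: "no_unit_gaps 0 xs" "length xs = l" "triples 0 xs = d" "doubles 0 xs = v"
      using triples_doubles_surj by meson
    \<comment> \<open>If the first entry were 0, all sizes would come from the tail and
      \<open>l\<close> could not occur.\<close>
    have pos: "\<forall>x\<in>set xs. 0 < x"
    proof (cases xs)
      case (Cons x ys)
      have "l \<noteq> 0" using Cons xs by auto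
      then have "l \<in> set d \<union> set v"
        using Max_in[of "insert 0 (set d \<union> set v)"] unfolding l_def[symmetric] by auto
      then have "0 < x"
        using xs Cons triples_bounds[of l x ys] doubles_bounds[of l x ys] by (cases "x = 0") auto
      then show ?thesis
        using xs(1) Cons unfolding no_unit_gaps_iff by auto
    qed auto
    have fz: "f (rev xs) = z"
      using xs dv by (simp add: f_def)
    \<comment> \<open>The two parameters of \<open>pairs\<close> are functions of \<open>z\<close>,
      so membership for two choices of them identifies these.\<close>
    have "z \<in> pairs distinct_partitions altsum (sum_list xs) (num_odd_parts (rev xs))"
      using f_in[of "rev xs"] xs fz by simp
    then have "sum_list (rev xs) = n" "num_odd_parts (rev xs) = m"
      using z by (auto simp: dv pairs_def)
    then show "z \<in> f ` {p. no_unit_gaps 0 (rev p) \<and> (\<forall>x\<in>set p. 0 < x) \<and> sum_list p = n \<and> num_odd_parts p = m}"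
      using fz xs pos by (intro image_eqI[of _ _ "rev xs"]) auto
  qed
  then show ?thesis by (rule bij_betw_same_card)
qed

lemma card_pairs_sylvester:
  "card (pairs distinct_partitions altsum n m) = card (pairs odd_partitions length n m)"
proof -
  have "bij_betw (map_prod sylvester id)
    (pairs distinct_partitions altsum n m) (pairs odd_partitions length n m)"
  proof (intro bij_betw_imageI inj_onI subset_antisym subsetI)
    fix z assume z: "z \<in> pairs odd_partitions length n m"
    then obtain p v where pv: "z = (p, v)" "p \<in> odd_partitions" by (auto simp: pairs_def)
    then obtain d where d: "d \<in> distinct_partitions" "sylvester d = p"
      using sylvester_surj by blast
    then have "(d, v) \<in> pairs distinct_partitions altsum n m"
      using z pv length_sylvester[of d] sum_list_sylvester[of d] by (auto simp: pairs_def)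
    then show "z \<in> map_prod sylvester id ` pairs distinct_partitions altsum n m"
      using d pv by force
  qed (auto simp: pairs_def sylvester_inj sylvester_in_odd_partitions length_sylvester
      sum_list_sylvester)
  then show ?thesis by (rule bij_betw_same_card)
qed

section \<open>Parts congruent to 0, 2, 3 or 4 modulo 6\<close>

lemma decreasing_eq_iff_mset:
  fixes p q :: "nat list"
  assumes "sorted_wrt (\<ge>) p" "sorted_wrt (\<ge>) q" "mset p = mset q"
  shows "p = q"
proof -
  have "sorted (rev p)" "sorted (rev q)" "mset (rev p) = mset (rev q)"
    using assms by (simp_all add: sorted_wrt_rev)
  then have "rev p = rev q"
    by (metis properties_for_sort sorted_sort_id)
  then show ?thesis by simp
qed

text \<open>The excluded residues 1 and 5 are those coprime to 6.\<close>

lemma mod6_iff: "(x::nat) mod 6 \<in> {0, 2, 3, 4} \<longleftrightarrow> even x \<or> 3 dvd x"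
  by simp presburger

text \<open>Parity separates the components: tripled odd parts stay odd, doubled parts are even.
  Hence the odd parts of the merged partition are counted by the length of the first
  component.\<close>

lemma card_mod6:
  "card {p \<in> partitions n. (\<forall>x\<in>set p. x mod 6 \<in> {0, 2, 3, 4}) \<and> num_odd_parts p = m}
    = card (pairs odd_partitions length n m)" (is "card ?B = card ?P")
proof -
  define g where "g = (\<lambda>(p, v). rev (sort (map ((*) 3) p @ map ((*) 2) v)) :: nat list)"
  have mset_g: "mset (g (p, v)) = mset (map ((*) 3) p) + mset (map ((*) 2) v)" for p v
    by (simp add: g_def)
  have sorted_g: "sorted_wrt (\<ge>) (g z)" for z
    by (simp add: g_def sorted_wrt_rev split: prod.splits)
  have "bij_betw g ?P ?B"
  proof (intro bij_betw_imageI inj_onI subset_antisym subsetI)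
    fix y z assume y: "y \<in> ?P" and z: "z \<in> ?P" and eq: "g y = g z"
    \<comment> \<open>Filtering by parity and dividing undoes the merge; multisets suffice, as both
      components are sorted.\<close>
    have rec: "mset p = image_mset (\<lambda>x. x div 3) (filter_mset odd (mset (g (p, v))))"
       "mset v = image_mset (\<lambda>x. x div 2) (filter_mset even (mset (g (p, v))))"
      if "(p, v) \<in> ?P" for p v
    proof -
      have "odd x" if "x \<in> set p" for x
        using that \<open>(p, v) \<in> ?P\<close> by (auto simp: pairs_def odd_partitions_def)
      then have o: "filter odd (map ((*) 3) p) = map ((*) 3) p" "filter even (map ((*) 3) p) = []"
        by (auto simp: filter_id_conv filter_empty_conv)
      have e: "filter even (map ((*) 2) v) = map ((*) 2) v" "filter odd (map ((*) 2) v) = []"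
        by (auto simp: filter_id_conv filter_empty_conv)
      show "mset p = image_mset (\<lambda>x. x div 3) (filter_mset odd (mset (g (p, v))))"
       "mset v = image_mset (\<lambda>x. x div 2) (filter_mset even (mset (g (p, v))))"
        unfolding mset_g filter_union_mset mset_filter[symmetric] o e
        by (simp_all add: multiset.map_comp comp_def)
    qed
    obtain p v p' v' where pv: "y = (p, v)" "z = (p', v')" by fastforce
    have "mset p = mset p'" "mset v = mset v'"
      using rec y z eq pv by metis+
    then show "y = z"
      using y z unfolding pv
      by (auto simp: pairs_def odd_partitions_def intro: decreasing_eq_iff_mset)
  next
    fix q assume "q \<in> g ` ?P"
    then obtain p v where pv: "(p, v) \<in> ?P" and q: "q = g (p, v)" by auto
    have set_q: "set q = (*) 3 ` set p \<union> (*) 2 ` set v"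
      using arg_cong[OF mset_g[of p v], of set_mset] q by simp
    have "sum_list q = n"
      using arg_cong[OF mset_g[of p v], of sum_mset] q pv
      by (simp add: pairs_def sum_mset_sum_list flip: sum_mset_distrib_left)
    moreover have "num_odd_parts q = m"
    proof -
      have "num_odd_parts q = size (filter_mset odd (mset q))"
        by (simp add: num_odd_parts_def flip: mset_filter)
      also have "\<dots> = length (filter odd (map ((*) 3) p)) + length (filter odd (map ((*) 2) v))"
        unfolding q mset_g filter_union_mset mset_filter[symmetric] size_union size_mset ..
      also have "filter odd (map ((*) 3) p) = map ((*) 3) p"
        using pv by (auto simp: filter_id_conv pairs_def odd_partitions_def)
      finally show ?thesis
        using pv by (simp add: pairs_def filter_map comp_def)
    qed
    moreover have "\<forall>x\<in>set q. 0 < x \<and> x mod 6 \<in> {0, 2, 3, 4}"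
    proof -
      have "\<forall>x\<in>set p. 0 < x" "\<forall>x\<in>set v. 0 < x"
        using pv by (auto simp: pairs_def odd_partitions_def intro: odd_pos)
      then show ?thesis
        unfolding mod6_iff set_q by auto
    qed
    ultimately show "q \<in> ?B"
      unfolding partitions_def using sorted_g q by blast
  next
    fix q assume "q \<in> ?B"
    then have q: "sorted_wrt (\<ge>) q \<and> (\<forall>x\<in>set q. 0 < x) \<and> sum_list q = n"
      "\<forall>x\<in>set q. even x \<or> 3 dvd x" "num_odd_parts q = m"
      unfolding partitions_def mem_Collect_eq mod6_iff by blast+
    define p where "p = map (\<lambda>x. x div 3) (filter odd q)"
    define v where "v = map (\<lambda>x. x div 2) (filter even q)"
    have mod: "even x \<or> 3 dvd x" "0 < x" if "x \<in> set q" for x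
      using q that by blast+
    have sq: "sorted_wrt (\<ge>) q"
      using q by simp
    \<comment> \<open>An odd part is divisible by 3 by the residue condition, so
      \<open>div 3\<close> is exact.\<close>
    have p3: "map ((*) 3) p = filter odd q"
      unfolding p_def map_map by (rule map_idI) (use mod(1) in fastforce)
    have v2: "map ((*) 2) v = filter even q"
      unfolding v_def map_map by (rule map_idI) auto
    have "mset (g (p, v)) = mset q"
      unfolding mset_g p3 v2 mset_filter
      using multiset_partition[of "mset q" odd] by simp
    then have g: "g (p, v) = q"
      using sorted_g sq by (intro decreasing_eq_iff_mset)
    have "sorted_wrt (\<ge>) p" "sorted_wrt (\<ge>) v"
      unfolding p_def v_def sorted_wrt_map
      by (rule sorted_wrt_mono_rel[OF _ sorted_wrt_filter[OF sq]], simp add: div_le_mono)+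
    moreover have "odd x" if "x \<in> set p" for x
    proof -
      have "3 * x \<in> set (filter odd q)" using that p3[symmetric] by simp
      then show ?thesis by simp
    qed
    moreover have "0 < x" if "x \<in> set v" for x
    proof -
      have "2 * x \<in> set (filter even q)" using that v2[symmetric] by simp
      then show ?thesis using mod by force
    qed
    moreover have "length p = m"
      using q by (simp add: p_def num_odd_parts_def)
    moreover have "3 * sum_list p + 2 * sum_list v = n"
      using arg_cong[OF mset_g[of p v], of sum_mset] q g
      by (simp add: sum_mset_sum_list flip: sum_mset_distrib_left)
    ultimately have "(p, v) \<in> ?P"
      by (auto simp: pairs_def odd_partitions_def)
    then show "q \<in> g ` ?P" using g by force
  qed
  then show ?thesis
    using bij_betw_same_card by fastforce
qed

theorem theorem1p3:
  fixes n m :: nat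
  shows "card {p \<in> partitions n. no_consecutive_parts p \<and> (\<forall>x\<in>set p. 2 \<le> x) \<and> num_odd_parts p = m}
       = card {p \<in> partitions n. (\<forall>x\<in>set p. x mod 6 \<in> {0, 2, 3, 4}) \<and> num_odd_parts p = m}"
  using card_no_consecutive card_pairs_sylvester card_mod6 by simp

end
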